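(* Let $G$ be a finite bipartite graph drawn in the plane with $n$ white and $n$ black vertices. Let $A$ be any generalized Kasteleyn matrix for $G$, let $\mathbf{a}\in H^1(G,\mathbb{S}^1)$ be the class defined by $A$, and let $\mathbf{k}\in H^1(G,\mathbb{Z}/(2))$ be the Kasteleyn class of $G$. Then $$|\det(A)|^2=\delta(\mathbf{a}+\mathbf{k},G).$$
   Context: Graphs are finite, simple, bipartite (vertices coloured white and black, edges joining white to black), drawn in the plane, and viewed as 1-dimensional CW-complexes. $\mathbb{S}^1$ denotes the additive group $\mathbb{R}/\mathbb{Z}$ and $\eta:\mathbb{S}^1\to\mathbb{C}$ is $\eta(x)=\exp(2\pi i x)$. The group $\mathbb{Z}/(2)$ is included in $\mathbb{S}^1$ by $m\mapsto m/2$, so $\eta(m)=(-1)^m$ on $\mathbb{Z}/(2)$; hence $H^1(G,\mathbb{Z}/(2))\subseteq H^1(G,\mathbb{S}^1)$. Cohomology classes are evaluated on closed 1-chains. Generalized Kasteleyn matrix: with white vertices and black vertices each numbered $1,\dots,n$, it is an $n\times n$ complex matrix $A$ with $|a_{ij}|=1$ if the $i$-th white and $j$-th black vertices are adjacent, and $a_{ij}=0$ otherwise. It corresponds to the 1-cochain $\mathbf{A}\in C^1(G,\mathbb{S}^1)$ with $a_{ij}=\eta(\mathbf{A}(e_{ij}))$, where $e_{ij}$ is the edge oriented from the $j$-th black to the $i$-th white vertex, and so defines a class $\mathbf{a}\in H^1(G,\mathbb{S}^1)$. Kasteleyn class: $\mathbf{k}\in H^1(G,\mathbb{Z}/(2))$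 is the unique class such that for every graph-theoretic cycle $C$ in $G$, $\mathbf{k}(C)\equiv m_C+l_C+1\pmod 2$, where $m_C$ is the number of vertices of $G$ in the interior of $C$ (in the plane) and $2l_C$ is the length of $C$. Matchings are perfect matchings. A matching is regarded as the 1-chain equal to the sum of its edges oriented from black to white; the difference of two matchings is closed. For $\mathbf{b}\in H^1(G,\mathbb{S}^1)$, $\delta(\mathbf{b},G)=\sum_{\mu_1,\mu_2}\eta(\mathbf{b}(\mu_1-\mu_2))$, where $\mu_1,\mu_2$ range over all matchings of $G$ (and $\delta(\mathbf{b},G)=0$ if $G$ has no matchings). *)

theory Defs
  imports
    "HOL-Analysis.Analysis"
    "HOL-Algebra.Coset"
    "HOL-Library.Z2"
    "HOL-Library.Poly_Mapping"
    "Jordan_Normal_Form.Determinant"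
begin

subsection \<open>The circle group\<close>

text \<open>\<open>circle\<close> is the additive group \<open>\<real>/\<int>\<close>.\<close>

quotient_type circle = real / "\<lambda>x y. x - y \<in> \<int>"
proof (rule equivpI)
  show "reflp (\<lambda>x y :: real. x - y \<in> \<int>)"
    by (simp add: reflp_def)
  show "symp (\<lambda>x y :: real. x - y \<in> \<int>)"
    by (auto simp: symp_def dest: Ints_minus)
  show "transp (\<lambda>x y :: real. x - y \<in> \<int>)"
  proof (rule transpI)
    fix x y z :: real
    assume "x - y \<in> \<int>" "y - z \<in> \<int>"
    then have "(x - y) + (y - z) \<in> \<int>" by (rule Ints_add)
    then show "x - z \<in> \<int>" by simp
  qed
qed

instantiation circle :: ab_group_add
begin

lift_definition zero_circle :: circle is "0 :: real" .

lift_definition plus_circle :: "circle \<Rightarrow> circle \<Rightarrow> circle" is "(+) :: real \<Rightarrow> real \<Rightarrow> real"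
  by (metis Ints_add add_diff_add)

lift_definition uminus_circle :: "circle \<Rightarrow> circle" is "uminus :: real \<Rightarrow> real"
  by (metis Ints_minus minus_diff_minus)

lift_definition minus_circle :: "circle \<Rightarrow> circle \<Rightarrow> circle" is "(-) :: real \<Rightarrow> real \<Rightarrow> real"
  by (metis Ints_diff add_diff_add add_uminus_conv_diff minus_diff_minus)

instance
  by standard (transfer; simp)+

end

lift_definition eta :: "circle \<Rightarrow> complex"
  is "\<lambda>x. exp (2 * complex_of_real pi * \<i> * complex_of_real x)"
proof -
  fix x y :: real
  assume "x - y \<in> \<int>"
  then obtain k where "x = y + of_int k"
    by (metis Ints_cases add.commute diff_add_cancel)
  then show "exp (2 * complex_of_real pi * \<i> * complex_of_real x) =
             exp (2 * complex_of_real pi * \<i> * complex_of_real y)"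
    by (auto simp: exp_eq intro!: exI[of _ k] simp: algebra_simps)
qed

text \<open>The inclusion \<open>m \<mapsto> m/2\<close> of \<open>\<int>/(2)\<close> into \<open>\<real>/\<int>\<close>.\<close>

definition half :: "bit \<Rightarrow> circle" where
  "half m = (if m = 0 then 0 else abs_circle (1/2))"


subsection \<open>Bipartite graphs drawn in the plane\<close>

text \<open>
  An edge is a pair (black vertex, white vertex), and is identified with the 1-cell oriented from
  black to white. The plane is \<open>\<complex>\<close>.
\<close>

record 'v drawn_graph =
  white :: "'v set"
  black :: "'v set"
  edges :: "('v \<times> 'v) set"
  pos :: "'v \<Rightarrow> complex"
  curve :: "'v \<times> 'v \<Rightarrow> real \<Rightarrow> complex"

definition verts :: "'v drawn_graph \<Rightarrow> 'v set" where
  "verts G = white G \<union> black G"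

locale plane_bipartite_graph =
  fixes G :: "'v drawn_graph"
  assumes finite_white: "finite (white G)"
    and finite_black: "finite (black G)"
    and disjoint: "white G \<inter> black G = {}"
    and edges_subset: "edges G \<subseteq> black G \<times> white G"
    and inj_pos: "inj_on (pos G) (verts G)"
    and arc_curve: "\<And>e. e \<in> edges G \<Longrightarrow> arc (curve G e)"
    and start_curve: "\<And>b w. (b, w) \<in> edges G \<Longrightarrow> pathstart (curve G (b, w)) = pos G b"
    and finish_curve: "\<And>b w. (b, w) \<in> edges G \<Longrightarrow> pathfinish (curve G (b, w)) = pos G w"
    and curve_verts: "\<And>b w. (b, w) \<in> edges G \<Longrightarrow>
          path_image (curve G (b, w)) \<inter> pos G ` verts G = {pos G b, pos G w}"
    and curve_curve: "\<And>e e'. e \<in> edges G \<Longrightarrow> e' \<in> edges G \<Longrightarrow> e \<noteq> e' \<Longrightarrow>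
          path_image (curve G e) \<inter> path_image (curve G e') \<subseteq> pos G ` verts G"


subsection \<open>Cellular cohomology of a graph\<close>

text \<open>
  Coefficients are in an arbitrary abelian group. A 1-chain is an element of the free abelian group
  on the edges. Since there are no 2-cells, every 1-cochain is a cocycle. Cochains are represented
  by functions vanishing off the edges, so that equality of cochains is equality of functions.
\<close>

definition C1 :: "'v drawn_graph \<Rightarrow> ('v \<times> 'v \<Rightarrow> 'g::ab_group_add) monoid" where
  "C1 G = \<lparr>carrier = {c. \<forall>e. e \<notin> edges G \<longrightarrow> c e = 0},
           mult = (\<lambda>c d e. c e + d e),
           one = (\<lambda>e. 0)\<rparr>"

definition coboundary :: "'v drawn_graph \<Rightarrow> ('v \<Rightarrow> 'g::ab_group_add) \<Rightarrow> 'v \<times> 'v \<Rightarrow> 'g" where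
  "coboundary G f = (\<lambda>(b, w). if (b, w) \<in> edges G then f w - f b else 0)"

definition B1 :: "'v drawn_graph \<Rightarrow> ('v \<times> 'v \<Rightarrow> 'g::ab_group_add) set" where
  "B1 G = range (coboundary G)"

definition H1 :: "'v drawn_graph \<Rightarrow> ('v \<times> 'v \<Rightarrow> 'g::ab_group_add) set monoid" where
  "H1 G = C1 G Mod B1 G"

definition cohomology_class ::
    "'v drawn_graph \<Rightarrow> ('v \<times> 'v \<Rightarrow> 'g::ab_group_add) \<Rightarrow> ('v \<times> 'v \<Rightarrow> 'g) set" where
  "cohomology_class G c = B1 G #>\<^bsub>C1 G\<^esub> c"

text \<open>The homomorphism of cohomology groups induced by a homomorphism of coefficient groups.\<close>

definition coeff_map ::
    "'v drawn_graph \<Rightarrow> ('g::ab_group_add \<Rightarrow> 'h::ab_group_add) \<Rightarrow>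
     ('v \<times> 'v \<Rightarrow> 'g) set \<Rightarrow> ('v \<times> 'v \<Rightarrow> 'h) set" where
  "coeff_map G h X = the_elem ((\<lambda>c. cohomology_class G (h \<circ> c)) ` X)"

definition int_mult :: "int \<Rightarrow> 'g::ab_group_add \<Rightarrow> 'g" where
  "int_mult k x = (\<Sum>i<nat k. x) - (\<Sum>i<nat (- k). x)"

definition eval_cochain ::
    "('v \<times> 'v \<Rightarrow> 'g::ab_group_add) \<Rightarrow> (('v \<times> 'v) \<Rightarrow>\<^sub>0 int) \<Rightarrow> 'g" where
  "eval_cochain c z = (\<Sum>e\<in>Poly_Mapping.keys z. int_mult (Poly_Mapping.lookup z e) (c e))"

text \<open>
  Evaluation of a cohomology class on a closed 1-chain: all representatives take the same value on
  a closed chain. The definition is meaningful for closed chains only.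
\<close>

definition eval_class ::
    "('v \<times> 'v \<Rightarrow> 'g::ab_group_add) set \<Rightarrow> (('v \<times> 'v) \<Rightarrow>\<^sub>0 int) \<Rightarrow> 'g" where
  "eval_class X z = the_elem ((\<lambda>c. eval_cochain c z) ` X)"


subsection \<open>Cycles and the Kasteleyn class\<close>

text \<open>
  A graph-theoretic cycle is given by the list of its vertices in cyclic order, so the length of
  the cycle is the length of the list.
\<close>

definition adjacent :: "'v drawn_graph \<Rightarrow> 'v \<Rightarrow> 'v \<Rightarrow> bool" where
  "adjacent G u v \<longleftrightarrow> (u, v) \<in> edges G \<or> (v, u) \<in> edges G"

definition cycle :: "'v drawn_graph \<Rightarrow> 'v list \<Rightarrow> bool" where
  "cycle G vs \<longleftrightarrow> 3 \<le> length vs \<and> distinct vs \<and>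
     (\<forall>i<length vs. adjacent G (vs ! i) (vs ! (Suc i mod length vs)))"

definition step_chain :: "'v drawn_graph \<Rightarrow> 'v \<Rightarrow> 'v \<Rightarrow> ('v \<times> 'v) \<Rightarrow>\<^sub>0 int" where
  "step_chain G u v = (if (u, v) \<in> edges G then frag_of (u, v) else - frag_of (v, u))"

definition cycle_chain :: "'v drawn_graph \<Rightarrow> 'v list \<Rightarrow> ('v \<times> 'v) \<Rightarrow>\<^sub>0 int" where
  "cycle_chain G vs = (\<Sum>i<length vs. step_chain G (vs ! i) (vs ! (Suc i mod length vs)))"

definition cycle_edges :: "'v drawn_graph \<Rightarrow> 'v list \<Rightarrow> ('v \<times> 'v) set" where
  "cycle_edges G vs = {e \<in> edges G. \<exists>i<length vs. {fst e, snd e} = {vs ! i, vs ! (Suc i mod length vs)}}"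

definition cycle_interior :: "'v drawn_graph \<Rightarrow> 'v list \<Rightarrow> complex set" where
  "cycle_interior G vs = inside (\<Union>e\<in>cycle_edges G vs. path_image (curve G e))"

definition interior_verts :: "'v drawn_graph \<Rightarrow> 'v list \<Rightarrow> 'v set" where
  "interior_verts G vs = {v \<in> verts G. pos G v \<in> cycle_interior G vs}"

text \<open>
  For a bipartite graph drawn in the plane exactly one class satisfies this predicate.
\<close>

definition kasteleyn_class :: "'v drawn_graph \<Rightarrow> ('v \<times> 'v \<Rightarrow> bit) set \<Rightarrow> bool" where
  "kasteleyn_class G k \<longleftrightarrow> k \<in> carrier (H1 G) \<and>
     (\<forall>vs. cycle G vs \<longrightarrow>
        eval_class k (cycle_chain G vs) =
          of_nat (card (interior_verts G vs) + length vs div 2 + 1))"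


subsection \<open>Generalized Kasteleyn matrices\<close>

text \<open>
  \<open>wh\<close> and \<open>bl\<close> number the white and the black vertices; as usual for \<open>'a mat\<close>, indices run over
  \<open>{..<n}\<close>.
\<close>

definition generalized_kasteleyn_matrix ::
    "'v drawn_graph \<Rightarrow> nat \<Rightarrow> (nat \<Rightarrow> 'v) \<Rightarrow> (nat \<Rightarrow> 'v) \<Rightarrow> complex mat \<Rightarrow> bool" where
  "generalized_kasteleyn_matrix G n wh bl A \<longleftrightarrow> A \<in> carrier_mat n n \<and>
     (\<forall>i<n. \<forall>j<n. if (bl j, wh i) \<in> edges G then cmod (A $$ (i, j)) = 1 else A $$ (i, j) = 0)"

definition matrix_cochain ::
    "'v drawn_graph \<Rightarrow> nat \<Rightarrow> (nat \<Rightarrow> 'v) \<Rightarrow> (nat \<Rightarrow> 'v) \<Rightarrow> complex mat \<Rightarrow> 'v \<times> 'v \<Rightarrow> circle" where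
  "matrix_cochain G n wh bl A = (THE c. c \<in> carrier (C1 G) \<and>
     (\<forall>i<n. \<forall>j<n. (bl j, wh i) \<in> edges G \<longrightarrow> A $$ (i, j) = eta (c (bl j, wh i))))"

definition matrix_class ::
    "'v drawn_graph \<Rightarrow> nat \<Rightarrow> (nat \<Rightarrow> 'v) \<Rightarrow> (nat \<Rightarrow> 'v) \<Rightarrow> complex mat \<Rightarrow>
     ('v \<times> 'v \<Rightarrow> circle) set" where
  "matrix_class G n wh bl A = cohomology_class G (matrix_cochain G n wh bl A)"


subsection \<open>Matchings\<close>

definition matchings :: "'v drawn_graph \<Rightarrow> ('v \<times> 'v) set set" where
  "matchings G = {M. M \<subseteq> edges G \<and> (\<forall>v\<in>verts G. \<exists>!e. e \<in> M \<and> (v = fst e \<or> v = snd e))}"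

definition matching_chain :: "('v \<times> 'v) set \<Rightarrow> ('v \<times> 'v) \<Rightarrow>\<^sub>0 int" where
  "matching_chain M = (\<Sum>e\<in>M. frag_of e)"

definition delta :: "('v \<times> 'v \<Rightarrow> circle) set \<Rightarrow> 'v drawn_graph \<Rightarrow> complex" where
  "delta X G = (\<Sum>M1\<in>matchings G. \<Sum>M2\<in>matchings G.
     eta (eval_class X (matching_chain M1 - matching_chain M2)))"

end

theory Submission
  imports Defs "HOL-Combinatorics.Cycles"
begin

text \<open>
  Expand \<open>det A\<close> over permutations. A permutation \<open>\<sigma>\<close> has a nonzero term exactly if it describes a
  matching of \<open>G\<close>, and then the term is the sign of \<open>\<sigma>\<close> times the value under \<open>eta\<close> of the matrix
  cochain on that matching. So the squared modulus of the determinant is the sum, over pairs of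
  matchings, of \<open>sign \<sigma> * sign \<tau> * eta (a (\<sigma> - \<tau>))\<close>, and the theorem amounts to the sign rule
  \<open>eta (half (k (\<sigma> - \<tau>))) = sign \<sigma> * sign \<tau>\<close> (lemma \<open>kasteleyn_sign\<close>).

  Both sides of the sign rule are multiplicative along chains of matchings, so it suffices to treat
  one step at a time. Writing \<open>\<sigma> = \<tau> \<circ> p\<close> and decomposing \<open>p\<close> into disjoint cycles gives a chain
  of matchings in which each differs from the previous one along a single cycle: because the cycles
  are disjoint, every partial product still uses only edges of \<open>G\<close>. If the step is given by an
  \<open>l\<close>-cycle with \<open>l \<ge> 2\<close>, the sign changes by the factor \<open>(-1) ^ (l - 1)\<close>, while the difference of
  the two matchings is a graph-theoretic cycle \<open>C\<close> of length \<open>2 * l\<close>, on which the Kasteleyn class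
  takes the value \<open>m + l + 1\<close>, where \<open>m\<close> is the number of vertices inside \<open>C\<close>.

  It remains to see that \<open>m\<close> is even (lemma \<open>even_card_interior_verts\<close>). The matchings pair the
  vertices of \<open>C\<close> among themselves. Therefore an edge of the matching that starts inside \<open>C\<close> has no
  endpoint on \<open>C\<close> and, the drawing being planar, does not meet \<open>C\<close> at all; so it stays in one component
  of the complement and ends inside \<open>C\<close> as well. The matching thus pairs the interior vertices
  with each other, and \<open>m + l + 1\<close> has the parity of \<open>l - 1\<close>.
\<close>

section \<open>The circle group and its elements of order two\<close>

lemma eta_0 [simp]: "eta 0 = 1"
  by transfer simp

lemma eta_add: "eta (x + y) = eta x * eta y"
  by transfer (simp add: algebra_simps exp_add)

lemma eta_uminus: "eta (- x) = cnj (eta x)"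
  by transfer (simp add: exp_cnj)

lemma eta_diff: "eta (x - y) = eta x * cnj (eta y)"
  by (metis diff_conv_add_uminus eta_add eta_uminus)

lemma eta_sum: "eta (\<Sum>i\<in>I. f i) = (\<Prod>i\<in>I. eta (f i))"
  by (induction I rule: infinite_finite_induct) (simp_all add: eta_add)

lemma inj_eta: "inj eta"
proof (rule injI)
  fix x y
  assume "eta x = eta y"
  then show "x = y"
  proof transfer
    fix x y :: real
    assume "exp (2 * complex_of_real pi * \<i> * complex_of_real x) =
      exp (2 * complex_of_real pi * \<i> * complex_of_real y)"
    then obtain k :: int where
      "2 * complex_of_real pi * \<i> * complex_of_real x =
       2 * complex_of_real pi * \<i> * complex_of_real y + of_int (2 * k) * complex_of_real pi * \<i>"
      by (auto simp: exp_eq)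
    then have "(2 * complex_of_real pi * \<i>) * complex_of_real x =
        (2 * complex_of_real pi * \<i>) * (complex_of_real (y + of_int k))"
      by (simp add: algebra_simps)
    then have "complex_of_real x = complex_of_real (y + of_int k)"
      by (simp del: of_real_add)
    then have "x = y + of_int k"
      by (simp only: of_real_eq_iff)
    then show "x - y \<in> \<int>" by simp
  qed
qed

lemma eta_surj_unit_circle:
  assumes "cmod z = 1"
  obtains t where "eta t = z"
proof
  show "eta (abs_circle (Arg z / (2 * pi))) = z"
    using assms Arg_eq[of z] by (cases "z = 0") (auto simp: eta.abs_eq mult_ac)
qed

lemma half_0 [simp]: "half 0 = 0"
  by (simp add: half_def)

lemma half_add: "half (x + y) = half x + half y"
proof -
  have "abs_circle (1/2) + abs_circle (1/2) = 0"
    by (simp add: plus_circle.abs_eq zero_circle.abs_eq circle.abs_eq_iff)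
  then show ?thesis
    by (cases x; cases y) (simp_all add: half_def)
qed

lemma half_sum: "half (\<Sum>i\<in>I. f i) = (\<Sum>i\<in>I. half (f i))"
  by (induction I rule: infinite_finite_induct) (simp_all add: half_add del: add_bit_eq_xor)

lemma half_diff: "half (x - y) = half x - half y"
  by (metis add_diff_cancel_right' diff_add_cancel half_add)

lemma eta_half_of_nat: "eta (half (of_nat m)) = (-1) ^ m"
proof (induction m)
  case (Suc m)
  have "eta (half 1) = -1"
    by (simp add: half_def eta.abs_eq)
  with Suc show ?case
    by (simp add: half_add eta_add del: add_bit_eq_xor)
qed simp

lemma bit_diff_commute: "x - y = y - (x :: bit)"
  by (cases x; cases y) simp_all

lemma of_nat_bit_eqI: "even m = even n \<Longrightarrow> of_nat m = (of_nat n :: bit)"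
proof -
  have *: "of_nat j = (if even j then 0 else 1 :: bit)" for j
    by (induction j) auto
  show "even m = even n \<Longrightarrow> of_nat m = (of_nat n :: bit)"
    by (simp add: *)
qed


section \<open>Evaluating cochains on chains\<close>

text \<open>
  Since \<open>int_mult\<close> treats positive and negative multipliers separately, its linearity is easiest to
  see after writing integers as differences of naturals, in any way.
\<close>

lemma int_mult_diff_of_nat: "int_mult (int m - int n) x = (\<Sum>i<m. x) - (\<Sum>i<n. x)"
proof -
  have add: "(\<Sum>i<a + b. x) = (\<Sum>i<a. x) + (\<Sum>i<b. x)" for a b :: nat
    by (induction b) (simp_all add: algebra_simps)
  show ?thesis
  proof (cases "n \<le> m")
    case True
    then obtain d where "m = n + d" by (auto simp: le_iff_add)
    then show ?thesis by (simp add: int_mult_def add)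
  next
    case False
    then obtain d where "n = m + d" using le_Suc_ex nat_le_linear by blast
    then show ?thesis by (simp add: int_mult_def add)
  qed
qed

lemma int_mult_simps [simp]:
  "int_mult 0 x = 0" "int_mult 1 x = x"
  by (simp_all add: int_mult_def)

lemma int_mult_diff_left: "int_mult (k - l) x = int_mult k x - int_mult l x"
proof -
  obtain a b where k: "k = int a - int b" by (rule int_diff_cases)
  obtain c d where l: "l = int c - int d" by (rule int_diff_cases)
  have add: "(\<Sum>i<a + b. x) = (\<Sum>i<a. x) + (\<Sum>i<b. x)" for a b :: nat
    by (induction b) (simp_all add: algebra_simps)
  have "k - l = int (a + d) - int (b + c)"
    by (simp add: k l)
  then show ?thesis
    by (simp only: k l int_mult_diff_of_nat add) (simp add: algebra_simps)
qed

lemma int_mult_add_right: "int_mult k (x + y) = int_mult k x + int_mult k y"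
  by (simp add: int_mult_def sum.distrib)

lemma eval_cochain_superset:
  assumes "finite S" "Poly_Mapping.keys z \<subseteq> S"
  shows "eval_cochain c z = (\<Sum>e\<in>S. int_mult (Poly_Mapping.lookup z e) (c e))"
  unfolding eval_cochain_def
  by (rule sum.mono_neutral_left) (use assms in \<open>auto simp: in_keys_iff\<close>)

lemma eval_cochain_0 [simp]: "eval_cochain c 0 = 0"
  by (simp add: eval_cochain_def)

lemma eval_cochain_frag_of [simp]: "eval_cochain c (frag_of e) = c e"
  by (simp add: eval_cochain_def)

lemma eval_cochain_diff: "eval_cochain c (z - z') = eval_cochain c z - eval_cochain c z'"
proof -
  let ?S = "Poly_Mapping.keys z \<union> Poly_Mapping.keys z'"
  have "Poly_Mapping.keys (z - z') \<subseteq> ?S"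
    by (rule keys_diff)
  then show ?thesis
    by (simp add: eval_cochain_superset[of ?S] lookup_minus int_mult_diff_left sum_subtractf)
qed

lemma eval_cochain_add: "eval_cochain c (z + z') = eval_cochain c z + eval_cochain c z'"
  using eval_cochain_diff[of c z "0 - z'"] eval_cochain_diff[of c 0 z'] by simp

lemma eval_cochain_sum: "eval_cochain c (\<Sum>i\<in>I. z i) = (\<Sum>i\<in>I. eval_cochain c (z i))"
  by (induction I rule: infinite_finite_induct) (simp_all add: eval_cochain_add)

lemma eval_cochain_add_cochain:
  "eval_cochain (\<lambda>e. c e + d e) z = eval_cochain c z + eval_cochain d z"
  by (simp add: eval_cochain_def int_mult_add_right sum.distrib)


section \<open>Cohomology classes\<close>

lemma comm_group_C1:
  fixes G :: "'v drawn_graph"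
  shows "comm_group (C1 G :: ('v \<times> 'v \<Rightarrow> 'g::ab_group_add) monoid)"
proof (rule comm_groupI)
  fix c :: "'v \<times> 'v \<Rightarrow> 'g"
  assume "c \<in> carrier (C1 G)"
  then have "(\<lambda>e. - c e) \<in> carrier (C1 G)" "(\<lambda>e. - c e) \<otimes>\<^bsub>C1 G\<^esub> c = \<one>\<^bsub>C1 G\<^esub>"
    by (auto simp: C1_def)
  then show "\<exists>d\<in>carrier (C1 G). d \<otimes>\<^bsub>C1 G\<^esub> c = \<one>\<^bsub>C1 G\<^esub>" by blast
qed (auto simp: C1_def add_ac)

lemma B1_subset_C1: "B1 G \<subseteq> carrier (C1 G)"
  by (auto simp: B1_def C1_def coboundary_def)

lemma B1_normal:
  fixes G :: "'v drawn_graph"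
  shows "(B1 G :: ('v \<times> 'v \<Rightarrow> 'g::ab_group_add) set) \<lhd> C1 G"
proof -
  interpret comm_group "C1 G :: ('v \<times> 'v \<Rightarrow> 'g) monoid" by (rule comm_group_C1)
  have "subgroup (B1 G :: ('v \<times> 'v \<Rightarrow> 'g) set) (C1 G)"
  proof (rule subgroupI)
    fix c :: "'v \<times> 'v \<Rightarrow> 'g"
    assume "c \<in> B1 G"
    then obtain f where c: "c = coboundary G f" by (auto simp: B1_def)
    have "inv\<^bsub>C1 G\<^esub> c = coboundary G (\<lambda>v. - f v)"
      by (rule inv_equality) (auto simp: c C1_def coboundary_def)
    then show "inv\<^bsub>C1 G\<^esub> c \<in> B1 G" by (simp add: B1_def)
  next
    fix c d :: "'v \<times> 'v \<Rightarrow> 'g"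
    assume "c \<in> B1 G" "d \<in> B1 G"
    then obtain f g where "c = coboundary G f" "d = coboundary G g" by (auto simp: B1_def)
    then have "c \<otimes>\<^bsub>C1 G\<^esub> d = coboundary G (\<lambda>v. f v + g v)"
      by (auto simp: C1_def coboundary_def)
    then show "c \<otimes>\<^bsub>C1 G\<^esub> d \<in> B1 G" by (simp add: B1_def)
  qed (use B1_subset_C1 in \<open>auto simp: B1_def\<close>)
  then show ?thesis by (rule subgroup_imp_normal)
qed

lemma cohomology_class_eq_range:
  "cohomology_class G c = range (\<lambda>f e. coboundary G f e + c e)"
  by (auto simp: cohomology_class_def r_coset_def B1_def C1_def)

lemma cohomology_class_add_coboundary:
  assumes "c \<in> carrier (C1 G)"
  shows "cohomology_class G (\<lambda>e. coboundary G f e + c e) = cohomology_class G c"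
proof -
  interpret normal "B1 G" "C1 G" by (rule B1_normal)
  show ?thesis
    unfolding cohomology_class_def
    using assms
    by (intro repr_independence[symmetric] is_subgroup)
      (auto simp: cohomology_class_eq_range[unfolded cohomology_class_def])
qed

lemma H1_mult_cohomology_class:
  assumes "c \<in> carrier (C1 G)" "d \<in> carrier (C1 G)"
  shows "cohomology_class G c \<otimes>\<^bsub>H1 G\<^esub> cohomology_class G d = cohomology_class G (\<lambda>e. c e + d e)"
proof -
  interpret normal "B1 G" "C1 G" by (rule B1_normal)
  have "c \<otimes>\<^bsub>C1 G\<^esub> d = (\<lambda>e. c e + d e)" by (simp add: C1_def)
  with rcos_sum[OF assms] show ?thesis
    by (simp add: H1_def cohomology_class_def)
qed

lemma H1_carrier_obtain:
  assumes "X \<in> carrier (H1 G)"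
  obtains c where "c \<in> carrier (C1 G)" "X = cohomology_class G c"
  using assms by (auto simp: H1_def carrier_FactGroup cohomology_class_def)

lemma coeff_map_cohomology_class:
  assumes h: "\<And>x y. h (x + y) = h x + h y" and c: "c \<in> carrier (C1 G)"
  shows "coeff_map G h (cohomology_class G c) = cohomology_class G (h \<circ> c)"
    and "h \<circ> c \<in> carrier (C1 G)"
proof -
  have h0: "h 0 = 0" using h[of 0 0] by simp
  have hd: "h (x - y) = h x - h y" for x y
    by (metis add_diff_cancel_right' diff_add_cancel h)
  show hc: "h \<circ> c \<in> carrier (C1 G)"
    using c by (simp add: C1_def h0)
  have "h \<circ> (\<lambda>e. coboundary G f e + c e) =
      (\<lambda>e. coboundary G (h \<circ> f) e + (h \<circ> c) e)" for f
    by (auto simp: coboundary_def h h0 hd)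
  then have "(\<lambda>c. cohomology_class G (h \<circ> c)) ` cohomology_class G c = {cohomology_class G (h \<circ> c)}"
    unfolding cohomology_class_eq_range[of G c]
    by (simp add: image_image cohomology_class_add_coboundary[OF hc] del: comp_apply)
  then show "coeff_map G h (cohomology_class G c) = cohomology_class G (h \<circ> c)"
    by (simp add: coeff_map_def)
qed

text \<open>
  Closedness of \<open>z\<close> enters through its dual form: coboundaries vanish on \<open>z\<close>, so the value does not
  depend on the representative.
\<close>

lemma eval_class_cohomology_class:
  fixes c :: "'v \<times> 'v \<Rightarrow> 'g::ab_group_add"
  assumes "\<And>f :: 'v \<Rightarrow> 'g. eval_cochain (coboundary G f) z = 0"
  shows "eval_class (cohomology_class G c) z = eval_cochain c z"
proof -
  have "(\<lambda>c. eval_cochain c z) ` cohomology_class G c = {eval_cochain c z}"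
    by (auto simp: cohomology_class_eq_range image_image eval_cochain_add_cochain assms)
  then show ?thesis by (simp add: eval_class_def)
qed

section \<open>Cyclic permutations\<close>

lemma sum_even_odd:
  "(\<Sum>i<2 * l. g i) = (\<Sum>j<l. g (2 * j) + g (Suc (2 * j)) :: 'a :: comm_monoid_add)"
  by (induction l) (simp_all add: add.assoc)

lemma sum_nth_distinct:
  assumes "distinct xs"
  shows "(\<Sum>j<length xs. g (xs ! j)) = sum g (set xs)"
  using sum.reindex_bij_betw[OF bij_betw_nth[OF assms refl refl]] by simp

lemma sign_cycle_of_list: "distinct cs \<Longrightarrow> sign (cycle_of_list cs) = (-1) ^ (length cs - 1)"
proof (induction cs rule: cycle_of_list.induct)
  case (1 i j cs)
  have "sign (cycle_of_list (i # j # cs)) = sign (Transposition.transpose i j) * sign (cycle_of_list (j # cs))"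
    unfolding cycle_of_list.simps(1)
    by (rule sign_compose[OF permutation_swap_id permutation_of_cycle])
  with 1 show ?case
    by (simp add: sign_swap_id del: cycle_of_list.simps(1))
qed simp_all

lemma cycle_of_list_nth:
  assumes "distinct cs" "i < length cs"
  shows "cycle_of_list cs (cs ! i) = cs ! (Suc i mod length cs)"
proof -
  have "map (cycle_of_list cs) cs = rotate1 cs"
    using cyclic_rotation[OF assms(1), of 1] by simp
  then show ?thesis
    using assms(2) by (metis nth_map nth_rotate1)
qed

lemma cycle_decomp_permutes: "cycle_decomp I p \<Longrightarrow> p permutes I"
proof (induction rule: cycle_decomp.induct)
  case empty
  show ?case by (rule permutes_id)
next
  case (comp I p cs)
  show ?case
  proof (rule permutes_compose)
    show "p permutes set cs \<union> I" using comp.IH by (rule permutes_subset) simp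
    show "cycle_of_list cs permutes set cs \<union> I"
      using cycle_permutes by (rule permutes_subset) simp
  qed
qed


section \<open>Matchings as permutations\<close>

locale numbered_plane_graph = plane_bipartite_graph G
  for G :: "'v drawn_graph" +
  fixes n :: nat and wh bl :: "nat \<Rightarrow> 'v"
  assumes wh: "bij_betw wh {..<n} (white G)"
    and bl: "bij_betw bl {..<n} (black G)"
begin

definition admissible :: "(nat \<Rightarrow> nat) \<Rightarrow> bool" where
  "admissible \<sigma> \<longleftrightarrow> \<sigma> permutes {..<n} \<and> (\<forall>i<n. (bl (\<sigma> i), wh i) \<in> edges G)"

definition permutation_matching :: "(nat \<Rightarrow> nat) \<Rightarrow> ('v \<times> 'v) set" where
  "permutation_matching \<sigma> = (\<lambda>i. (bl (\<sigma> i), wh i)) ` {..<n}"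

lemma wh_eq_iff: "i < n \<Longrightarrow> j < n \<Longrightarrow> wh i = wh j \<longleftrightarrow> i = j"
  using wh by (auto simp: bij_betw_def inj_on_def)

lemma bl_eq_iff: "i < n \<Longrightarrow> j < n \<Longrightarrow> bl i = bl j \<longleftrightarrow> i = j"
  using bl by (auto simp: bij_betw_def inj_on_def)

lemma wh_white: "i < n \<Longrightarrow> wh i \<in> white G"
  using wh by (auto simp: bij_betw_def)

lemma bl_black: "i < n \<Longrightarrow> bl i \<in> black G"
  using bl by (auto simp: bij_betw_def)

lemma white_obtain: assumes "w \<in> white G" obtains i where "i < n" "w = wh i"
  using assms wh by (auto simp: bij_betw_def)

lemma black_obtain: assumes "b \<in> black G" obtains i where "i < n" "b = bl i"
  using assms bl by (auto simp: bij_betw_def)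

lemma bl_neq_wh: "i < n \<Longrightarrow> j < n \<Longrightarrow> bl i \<noteq> wh j"
  using disjoint wh_white bl_black by fastforce

lemma permutes_less: "\<sigma> permutes {..<n} \<Longrightarrow> \<sigma> i < n \<longleftrightarrow> i < n"
  using permutes_in_image[of \<sigma> "{..<n}" i] by simp

lemma matching_chain_permutation_matching:
  "matching_chain (permutation_matching \<sigma>) = (\<Sum>i<n. frag_of (bl (\<sigma> i), wh i))"
proof -
  have "inj_on (\<lambda>i. (bl (\<sigma> i), wh i)) {..<n}"
    by (auto simp: inj_on_def wh_eq_iff)
  then show ?thesis
    by (simp add: matching_chain_def permutation_matching_def sum.reindex)
qed

lemma eval_cochain_matching_chain:
  "eval_cochain c (matching_chain (permutation_matching \<sigma>)) = (\<Sum>i<n. c (bl (\<sigma> i), wh i))"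
  by (simp add: matching_chain_permutation_matching eval_cochain_sum)

lemma eval_cochain_matching_diff:
  "eval_cochain c (matching_chain (permutation_matching \<sigma>) - matching_chain (permutation_matching \<tau>)) =
     (\<Sum>i<n. c (bl (\<sigma> i), wh i)) - (\<Sum>i<n. c (bl (\<tau> i), wh i))"
  by (simp add: eval_cochain_diff eval_cochain_matching_chain)

text \<open>
  On a coboundary every matching takes the same value, since it meets every vertex exactly once.
\<close>

lemma matching_diff_closed:
  assumes "admissible \<sigma>" "admissible \<tau>"
  shows "eval_cochain (coboundary G f)
    (matching_chain (permutation_matching \<sigma>) - matching_chain (permutation_matching \<tau>)) = 0"
proof -
  have "(\<Sum>i<n. coboundary G f (bl (\<rho> i), wh i)) = (\<Sum>i<n. f (wh i)) - (\<Sum>i<n. f (bl i))"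
    if "admissible \<rho>" for \<rho>
  proof -
    have "(\<Sum>i<n. coboundary G f (bl (\<rho> i), wh i)) = (\<Sum>i<n. f (wh i) - f (bl (\<rho> i)))"
      by (rule sum.cong) (use that in \<open>auto simp: admissible_def coboundary_def\<close>)
    also have "\<dots> = (\<Sum>i<n. f (wh i)) - (\<Sum>i<n. f (bl i))"
      using that sum.permute[of \<rho> "{..<n}" "\<lambda>i. f (bl i)"]
      by (simp add: sum_subtractf admissible_def o_def)
    finally show ?thesis .
  qed
  with assms show ?thesis
    by (simp add: eval_cochain_matching_diff)
qed

lemma permutation_matching_in_matchings:
  assumes "admissible \<sigma>"
  shows "permutation_matching \<sigma> \<in> matchings G"
proof -
  have \<sigma>: "\<sigma> permutes {..<n}" and e: "\<And>i. i < n \<Longrightarrow> (bl (\<sigma> i), wh i) \<in> edges G"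
    using assms by (auto simp: admissible_def)
  have "\<exists>!e. e \<in> permutation_matching \<sigma> \<and> (v = fst e \<or> v = snd e)" if "v \<in> verts G" for v
  proof (cases "v \<in> white G")
    case True
    then obtain i where i: "i < n" "v = wh i" by (rule white_obtain)
    show ?thesis
    proof (rule ex1I[of _ "(bl (\<sigma> i), wh i)"])
      fix e assume "e \<in> permutation_matching \<sigma> \<and> (v = fst e \<or> v = snd e)"
      then obtain j where j: "j < n" "e = (bl (\<sigma> j), wh j)" "wh i = bl (\<sigma> j) \<or> wh i = wh j"
        using i by (auto simp: permutation_matching_def)
      then have "i = j"
        using i bl_neq_wh[of "\<sigma> j" i] \<sigma> by (auto simp: permutes_less wh_eq_iff)
      then show "e = (bl (\<sigma> i), wh i)" using j by simp
    qed (use i in \<open>auto simp: permutation_matching_def\<close>)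
  next
    case False
    with that have "v \<in> black G" by (simp add: verts_def)
    then obtain j where j: "j < n" "v = bl j" by (rule black_obtain)
    have "\<sigma> ` {..<n} = {..<n}" using \<sigma> by (rule permutes_image)
    with j obtain i where i: "i < n" "j = \<sigma> i" by blast
    show ?thesis
    proof (rule ex1I[of _ "(bl (\<sigma> i), wh i)"])
      fix e assume "e \<in> permutation_matching \<sigma> \<and> (v = fst e \<or> v = snd e)"
      then obtain i' where i': "i' < n" "e = (bl (\<sigma> i'), wh i')" "bl j = bl (\<sigma> i') \<or> bl j = wh i'"
        using j by (auto simp: permutation_matching_def)
      then have "\<sigma> i = \<sigma> i'"
        using i j bl_neq_wh[of j i'] \<sigma> by (auto simp: permutes_less bl_eq_iff)
      then have "i = i'" using permutes_inj[OF \<sigma>] by (simp add: inj_eq)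
      then show "e = (bl (\<sigma> i), wh i)" using i' by simp
    qed (use i j in \<open>auto simp: permutation_matching_def\<close>)
  qed
  then show ?thesis
    using e by (auto simp: matchings_def permutation_matching_def)
qed

lemma inj_on_permutation_matching: "inj_on permutation_matching (Collect admissible)"
proof (rule inj_onI)
  fix \<sigma> \<tau>
  assume "\<sigma> \<in> Collect admissible" "\<tau> \<in> Collect admissible"
    and eq: "permutation_matching \<sigma> = permutation_matching \<tau>"
  then have \<sigma>: "\<sigma> permutes {..<n}" and \<tau>: "\<tau> permutes {..<n}"
    by (auto simp: admissible_def)
  show "\<sigma> = \<tau>"
  proof
    fix i
    show "\<sigma> i = \<tau> i"
    proof (cases "i < n")
      case True
      then have "(bl (\<sigma> i), wh i) \<in> permutation_matching \<sigma>"
        by (auto simp: permutation_matching_def)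
      then have "(bl (\<sigma> i), wh i) \<in> permutation_matching \<tau>"
        by (simp only: eq)
      then obtain j where "j < n" "bl (\<sigma> i) = bl (\<tau> j)" "wh i = wh j"
        by (auto simp: permutation_matching_def)
      with True \<sigma> \<tau> show ?thesis
        by (auto simp: wh_eq_iff bl_eq_iff permutes_less)
    next
      case False
      then show ?thesis using \<sigma> \<tau> by (simp add: permutes_def)
    qed
  qed
qed

lemma matching_obtain_permutation:
  assumes M: "M \<in> matchings G"
  obtains \<sigma> where "admissible \<sigma>" "permutation_matching \<sigma> = M"
proof -
  have sub: "M \<subseteq> edges G"
    and ex1: "\<And>v. v \<in> verts G \<Longrightarrow> \<exists>!e. e \<in> M \<and> (v = fst e \<or> v = snd e)"
    using M by (auto simp: matchings_def)
  have ex1_D: "e = e'"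
    if "v \<in> verts G" "e \<in> M" "e' \<in> M" "v = fst e \<or> v = snd e" "v = fst e' \<or> v = snd e'" for v e e'
    using ex1[OF that(1)] that(2-) by (elim ex1E) metis
  have "\<exists>j<n. (bl j, wh i) \<in> M" if i: "i < n" for i
  proof -
    have "wh i \<in> verts G" using wh_white[OF i] by (simp add: verts_def)
    from ex1_implies_ex[OF ex1[OF this]] obtain b w
      where e: "(b, w) \<in> M" "wh i = b \<or> wh i = w"
      by (metis prod.collapse)
    then have "b \<in> black G" "w \<in> white G" using sub edges_subset by auto
    then obtain j where j: "j < n" "b = bl j" by (auto elim: black_obtain)
    then have "wh i = w" using e bl_neq_wh[OF j(1) i] by auto
    then show ?thesis using e j by auto
  qed
  then obtain s where s: "\<And>i. i < n \<Longrightarrow> s i < n \<and> (bl (s i), wh i) \<in> M" by metis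
  define \<sigma> where "\<sigma> i = (if i < n then s i else i)" for i
  have "inj_on \<sigma> {..<n}"
  proof (rule inj_onI)
    fix i j
    assume ij: "i \<in> {..<n}" "j \<in> {..<n}" "\<sigma> i = \<sigma> j"
    then have mem: "(bl (s i), wh i) \<in> M" "(bl (s i), wh j) \<in> M"
      using s[of i] s[of j] by (auto simp: \<sigma>_def)
    have "bl (s i) \<in> verts G"
      using ij s[of i] bl_black by (simp add: verts_def)
    from ex1_D[OF this, of "(bl (s i), wh i)" "(bl (s i), wh j)"] mem
    have "(bl (s i), wh i) = (bl (s i), wh j)" by simp
    then show "i = j" using ij by (simp add: wh_eq_iff)
  qed
  moreover have "\<sigma> ` {..<n} \<subseteq> {..<n}" using s by (auto simp: \<sigma>_def)
  ultimately have "bij_betw \<sigma> {..<n} {..<n}"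
    by (simp add: bij_betw_def endo_inj_surj)
  then have perm: "\<sigma> permutes {..<n}"
    by (rule bij_imp_permutes) (simp add: \<sigma>_def)
  then have adm: "admissible \<sigma>"
    using s sub by (auto simp: admissible_def \<sigma>_def)
  have "e \<in> permutation_matching \<sigma>" if e: "e \<in> M" for e
  proof -
    obtain b w where bw: "e = (b, w)" by (cases e)
    then have "w \<in> white G" using e sub edges_subset by auto
    then obtain i where i: "i < n" "w = wh i" by (rule white_obtain)
    have "wh i \<in> verts G" using wh_white[OF i(1)] by (simp add: verts_def)
    from ex1_D[OF this, of e "(bl (s i), wh i)"] have "e = (bl (s i), wh i)"
      using e bw i s[OF i(1)] by simp
    then show ?thesis using i by (auto simp: permutation_matching_def \<sigma>_def)
  qed
  moreover have "permutation_matching \<sigma> \<subseteq> M"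
    using s by (auto simp: permutation_matching_def \<sigma>_def)
  ultimately have "permutation_matching \<sigma> = M" by blast
  with adm show thesis by (rule that)
qed

lemma bij_betw_permutation_matching:
  "bij_betw permutation_matching (Collect admissible) (matchings G)"
proof (rule bij_betw_imageI[OF inj_on_permutation_matching])
  show "permutation_matching ` Collect admissible = matchings G"
    using permutation_matching_in_matchings by (auto elim: matching_obtain_permutation)
qed


section \<open>Two matchings that differ by one cycle\<close>

text \<open>
  Row \<open>i\<close> stands for the white vertex \<open>wh i\<close>. If \<open>\<rho> = \<sigma> \<circ> c\<close> with \<open>c\<close> the cyclic permutation of
  \<open>cs\<close>, then the black partner of \<open>wh i\<close> under \<open>\<rho>\<close> is the partner of \<open>wh (c i)\<close> under \<open>\<sigma>\<close>. So a
  \<open>\<rho>\<close>-edge followed by a \<open>\<sigma>\<close>-edge leads from \<open>wh i\<close> to \<open>wh (c i)\<close>, and \<open>vs\<close> is the closed walk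
  obtained by alternating the two: white vertices at even, black vertices at odd positions.
  For \<open>length cs = 1\<close> this would go back and forth along one edge, which is not a cycle; hence the
  bound \<open>2 \<le> length cs\<close>.
\<close>

context
  fixes \<sigma> \<rho> :: "nat \<Rightarrow> nat" and cs :: "nat list" and vs :: "'v list"
  assumes \<sigma>: "admissible \<sigma>" and \<rho>: "admissible \<rho>"
    and cs: "distinct cs" "set cs \<subseteq> {..<n}" "2 \<le> length cs"
    and \<rho>_eq: "\<rho> = \<sigma> \<circ> cycle_of_list cs"
    and vs_eq: "vs = map (\<lambda>m. if even m then wh (cs ! (m div 2)) else bl (\<rho> (cs ! (m div 2))))
                  [0..<2 * length cs]"
begin

lemma length_vs: "length vs = 2 * length cs"
  by (simp add: vs_eq)

lemma vs_nth_if: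
  assumes "m < 2 * length cs"
  shows "vs ! m = (if even m then wh (cs ! (m div 2)) else bl (\<rho> (cs ! (m div 2))))"
proof -
  have "m < length [0..<2 * length cs]" using assms by simp
  from nth_map[OF this] show ?thesis using assms unfolding vs_eq by simp
qed

lemma vs_nth:
  assumes "j < length cs"
  shows "vs ! (2 * j) = wh (cs ! j)"
    and "vs ! (Suc (2 * j)) = bl (\<rho> (cs ! j))"
    and "vs ! (Suc (2 * j) mod length vs) = bl (\<rho> (cs ! j))"
    and "vs ! (Suc (Suc (2 * j)) mod length vs) = wh (cycle_of_list cs (cs ! j))"
proof -
  have less: "Suc (2 * j) < 2 * length cs" "2 * j < 2 * length cs" using assms by simp_all
  show "vs ! (2 * j) = wh (cs ! j)" using vs_nth_if[OF less(2)] by simp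
  show *: "vs ! (Suc (2 * j)) = bl (\<rho> (cs ! j))" using vs_nth_if[OF less(1)] by simp
  show "vs ! (Suc (2 * j) mod length vs) = bl (\<rho> (cs ! j))"
    unfolding length_vs mod_less[OF less(1)] by (rule *)
  have "Suc (Suc (2 * j)) mod length vs = 2 * (Suc j mod length cs)"
    unfolding length_vs mult_mod_right by simp
  moreover have "2 * (Suc j mod length cs) < 2 * length cs"
    using assms by (intro mult_strict_left_mono mod_less_divisor) auto
  ultimately show "vs ! (Suc (Suc (2 * j)) mod length vs) = wh (cycle_of_list cs (cs ! j))"
    using vs_nth_if cycle_of_list_nth[OF cs(1) assms] by simp
qed

lemma index_cases:
  assumes "m < length vs"
  obtains j where "j < length cs" "m = 2 * j" | j where "j < length cs" "m = Suc (2 * j)"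
  using assms by (cases "even m") (auto elim!: evenE oddE simp: length_vs)

lemma \<sigma>_permutes: "\<sigma> permutes {..<n}" and \<rho>_permutes: "\<rho> permutes {..<n}"
  and \<sigma>_edge: "i < n \<Longrightarrow> (bl (\<sigma> i), wh i) \<in> edges G"
  and \<rho>_edge: "i < n \<Longrightarrow> (bl (\<rho> i), wh i) \<in> edges G"
  using \<sigma> \<rho> by (auto simp: admissible_def)

lemma cs_less: "j < length cs \<Longrightarrow> cs ! j < n"
  using cs(2) by (auto simp: subset_iff)

lemma cycle_in_cs: "x \<in> set cs \<Longrightarrow> cycle_of_list cs x \<in> set cs"
  using cycle_is_surj[OF cs(1)] by blast

lemma set_vs: "set vs = wh ` set cs \<union> bl ` \<sigma> ` set cs"
proof -
  have "\<rho> ` set cs = \<sigma> ` set cs"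
    by (simp only: \<rho>_eq image_comp[symmetric] cycle_is_surj[OF cs(1)])
  moreover have "set vs = wh ` set cs \<union> bl ` \<rho> ` set cs"
  proof (intro equalityI subsetI)
    fix v assume "v \<in> set vs"
    then obtain m where m: "m < length vs" "v = vs ! m" by (auto simp: in_set_conv_nth)
    from m(1) show "v \<in> wh ` set cs \<union> bl ` \<rho> ` set cs"
      by (cases rule: index_cases) (auto simp: m vs_nth)
  next
    fix v assume "v \<in> wh ` set cs \<union> bl ` \<rho> ` set cs"
    then obtain j where j: "j < length cs" "v = vs ! (2 * j) \<or> v = vs ! Suc (2 * j)"
      by (auto simp: in_set_conv_nth vs_nth)
    then have "2 * j < length vs" "Suc (2 * j) < length vs" by (simp_all add: length_vs)
    with j(2) show "v \<in> set vs" by auto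
  qed
  ultimately show ?thesis by simp
qed

lemma distinct_vs: "distinct vs"
proof -
  have W: "wh (cs ! i) = wh (cs ! j) \<longleftrightarrow> i = j"
    and B: "bl (\<rho> (cs ! i)) = bl (\<rho> (cs ! j)) \<longleftrightarrow> i = j"
    and WB: "wh (cs ! i) \<noteq> bl (\<rho> (cs ! j))" "bl (\<rho> (cs ! j)) \<noteq> wh (cs ! i)"
    if "i < length cs" "j < length cs" for i j
    using that cs(1) \<rho>_permutes bl_neq_wh[of "\<rho> (cs ! j)" "cs ! i"]
    by (auto simp: wh_eq_iff bl_eq_iff cs_less permutes_less nth_eq_iff_index_eq
        inj_eq[OF permutes_inj])
  show ?thesis
    unfolding distinct_conv_nth
  proof (intro allI impI)
    fix i j
    assume "i < length vs" "j < length vs" "i \<noteq> j"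
    from \<open>i < length vs\<close> \<open>j < length vs\<close> \<open>i \<noteq> j\<close> show "vs ! i \<noteq> vs ! j"
      by (elim index_cases) (auto simp: vs_nth W B WB)
  qed
qed

lemma cycle_vs: "Defs.cycle G vs"
  unfolding Defs.cycle_def
proof (intro conjI allI impI)
  show "3 \<le> length vs" using cs(3) by (simp add: length_vs)
  show "distinct vs" by (rule distinct_vs)
  fix m assume "m < length vs"
  then show "adjacent G (vs ! m) (vs ! (Suc m mod length vs))"
  proof (cases rule: index_cases)
    case (1 j)
    then show ?thesis
      using \<rho>_edge[OF cs_less] by (simp add: vs_nth adjacent_def)
  next
    case (2 j)
    then have "cycle_of_list cs (cs ! j) < n" using cycle_in_cs[of "cs ! j"] cs(2) by auto
    with 2 show ?thesis
      using \<sigma>_edge by (simp add: vs_nth adjacent_def \<rho>_eq)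
  qed
qed

text \<open>
  The walk runs through the \<open>\<rho>\<close>-edges from white to black and through the \<open>\<sigma>\<close>-edges from black to
  white, which accounts for the signs. Edges outside the cycle belong to both matchings and cancel.
\<close>

lemma cycle_chain_vs:
  "cycle_chain G vs =
     matching_chain (permutation_matching \<sigma>) - matching_chain (permutation_matching \<rho>)"
proof -
  define s where "s x = frag_of (bl (\<sigma> x), wh x)" for x
  define r where "r x = frag_of (bl (\<rho> x), wh x)" for x
  let ?c = "cycle_of_list cs"
  have wb: "(wh i, bl j) \<notin> edges G" if "i < n" for i j
    using wh_white[OF that] disjoint edges_subset by auto
  have "cycle_chain G vs =
      (\<Sum>j<length cs. step_chain G (vs ! (2 * j)) (vs ! (Suc (2 * j) mod length vs)) +
         step_chain G (vs ! Suc (2 * j)) (vs ! (Suc (Suc (2 * j)) mod length vs)))"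
    by (simp only: cycle_chain_def length_vs sum_even_odd)
  also have "\<dots> = (\<Sum>j<length cs. s (?c (cs ! j)) - r (cs ! j))"
  proof (rule sum.cong[OF refl])
    fix j assume "j \<in> {..<length cs}"
    then have j: "j < length cs" by simp
    then have "?c (cs ! j) < n" using cycle_in_cs[of "cs ! j"] cs(2) by auto
    then have "(bl (\<rho> (cs ! j)), wh (?c (cs ! j))) \<in> edges G"
      using \<sigma>_edge by (simp add: \<rho>_eq)
    then show "step_chain G (vs ! (2 * j)) (vs ! (Suc (2 * j) mod length vs)) +
        step_chain G (vs ! Suc (2 * j)) (vs ! (Suc (Suc (2 * j)) mod length vs)) =
        s (?c (cs ! j)) - r (cs ! j)"
      using j by (simp add: vs_nth step_chain_def wb[OF cs_less] s_def r_def \<rho>_eq)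
  qed
  also have "\<dots> = (\<Sum>x\<in>set cs. s (?c x)) - (\<Sum>x\<in>set cs. r x)"
    using cs(1) by (simp add: sum_nth_distinct[where g = "\<lambda>x. s (?c x)"]
        sum_nth_distinct[where g = r] sum_subtractf)
  also have "(\<Sum>x\<in>set cs. s (?c x)) = (\<Sum>x\<in>set cs. s x)"
    using sum.permute[OF cycle_permutes, of s cs] by (simp add: o_def)
  also have "(\<Sum>x\<in>set cs. s x) - (\<Sum>x\<in>set cs. r x) = (\<Sum>x\<in>set cs. s x - r x)"
    by (simp add: sum_subtractf)
  also have "\<dots> = (\<Sum>x<n. s x - r x)"
    using cs(2) by (intro sum.mono_neutral_left) (auto simp: s_def r_def \<rho>_eq id_outside_supp)
  finally show ?thesis
    by (simp add: s_def r_def sum_subtractf matching_chain_permutation_matching)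
qed

lemma pos_on_cycle:
  assumes "x \<in> set cs"
  shows "pos G (wh x) \<in> (\<Union>e\<in>cycle_edges G vs. path_image (curve G e))"
    and "pos G (bl (\<sigma> x)) \<in> (\<Union>e\<in>cycle_edges G vs. path_image (curve G e))"
proof -
  obtain y where y: "y \<in> set cs" "x = cycle_of_list cs y"
    using cycle_is_surj[OF cs(1)] assms by blast
  then obtain j where j: "j < length cs" "y = cs ! j" by (auto simp: in_set_conv_nth)
  have "{bl (\<sigma> x), wh x} = {vs ! (Suc (2 * j)), vs ! (Suc (Suc (2 * j)) mod length vs)}"
    using j y by (simp add: vs_nth \<rho>_eq)
  moreover have "Suc (2 * j) < length vs" using j by (simp add: length_vs)
  moreover have E: "(bl (\<sigma> x), wh x) \<in> edges G" using \<sigma>_edge assms cs(2) by auto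
  ultimately have mem: "(bl (\<sigma> x), wh x) \<in> cycle_edges G vs"
    by (auto simp: cycle_edges_def)
  have "pos G (wh x) \<in> path_image (curve G (bl (\<sigma> x), wh x))"
    "pos G (bl (\<sigma> x)) \<in> path_image (curve G (bl (\<sigma> x), wh x))"
    using curve_verts[OF E] by blast+
  with mem show "pos G (wh x) \<in> (\<Union>e\<in>cycle_edges G vs. path_image (curve G e))"
    and "pos G (bl (\<sigma> x)) \<in> (\<Union>e\<in>cycle_edges G vs. path_image (curve G e))"
    by blast+
qed

text \<open>
  Edges of the drawing meet only in common endpoints, and the \<open>\<sigma>\<close>-partner of a vertex off the
  cycle is off the cycle too, because \<open>\<sigma>\<close> matches the vertices of the cycle among themselves.
\<close>

lemma matching_edge_avoids_cycle:
  assumes x: "x < n" "x \<notin> set cs"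
  shows "path_image (curve G (bl (\<sigma> x), wh x)) \<inter>
    (\<Union>e\<in>cycle_edges G vs. path_image (curve G e)) = {}"
proof (rule ccontr)
  have \<sigma>x: "\<sigma> x < n" using x \<sigma>_permutes by (simp add: permutes_less)
  have wx: "wh x \<notin> set vs"
  proof
    assume "wh x \<in> set vs"
    then consider y where "y \<in> set cs" "wh x = wh y" | y where "y \<in> set cs" "wh x = bl (\<sigma> y)"
      by (auto simp: set_vs)
    then show False
    proof cases
      case 1 then show False using x cs(2) by (auto simp: wh_eq_iff)
    next
      case (2 y)
      then have "\<sigma> y < n" using \<sigma>_permutes cs(2) by (auto simp: permutes_less)
      then show False using 2 x bl_neq_wh[of "\<sigma> y" x] by simp
    qed
  qed
  have bx: "bl (\<sigma> x) \<notin> set vs"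
  proof
    assume "bl (\<sigma> x) \<in> set vs"
    then consider y where "y \<in> set cs" "bl (\<sigma> x) = wh y"
      | y where "y \<in> set cs" "bl (\<sigma> x) = bl (\<sigma> y)"
      by (auto simp: set_vs)
    then show False
    proof cases
      case (1 y) then show False using bl_neq_wh[OF \<sigma>x, of y] cs(2) by auto
    next
      case (2 y)
      then have "\<sigma> x = \<sigma> y" using \<sigma>x \<sigma>_permutes cs(2) by (auto simp: permutes_less bl_eq_iff)
      then show False using 2 x by (simp add: inj_eq[OF permutes_inj[OF \<sigma>_permutes]])
    qed
  qed
  assume "\<not> ?thesis"
  then obtain p e where p: "p \<in> path_image (curve G (bl (\<sigma> x), wh x))"
    and e: "e \<in> cycle_edges G vs" "p \<in> path_image (curve G e)"
    by blast
  obtain b w where bw: "e = (b, w)" by (cases e)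
  have eG: "(b, w) \<in> edges G" using e bw by (auto simp: cycle_edges_def)
  have on: "b \<in> set vs" "w \<in> set vs"
  proof -
    obtain i where i: "i < length vs" "{b, w} = {vs ! i, vs ! (Suc i mod length vs)}"
      using e bw by (auto simp: cycle_edges_def)
    then have "vs \<noteq> []" by auto
    then have "Suc i mod length vs < length vs" by simp
    then have "{b, w} \<subseteq> set vs" using i by simp
    then show "b \<in> set vs" "w \<in> set vs" by auto
  qed
  then have ne: "(bl (\<sigma> x), wh x) \<noteq> e" using wx bw by auto
  have "p \<in> pos G ` verts G"
    using curve_curve[OF \<sigma>_edge[OF x(1)] _ ne] e p eG bw by auto
  then have "p \<in> {pos G (bl (\<sigma> x)), pos G (wh x)}" "p \<in> {pos G b, pos G w}"
    using curve_verts[OF \<sigma>_edge[OF x(1)]] curve_verts[OF eG] p e bw by blast+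
  moreover have "bl (\<sigma> x) \<in> verts G" "wh x \<in> verts G" "b \<in> verts G" "w \<in> verts G"
    using bl_black[OF \<sigma>x] wh_white[OF x(1)] eG edges_subset by (auto simp: verts_def)
  ultimately have "{bl (\<sigma> x), wh x} \<inter> {b, w} \<noteq> {}"
    using inj_pos by (auto simp: inj_on_def)
  with wx bx on show False by auto
qed

text \<open>
  A matching edge off the cycle is a connected set in the complement of the cycle, and the inside
  is a union of components of that complement. For an edge on the cycle neither endpoint is inside.
\<close>

lemma matched_vertices_interior_iff:
  assumes "x < n"
  shows "pos G (bl (\<sigma> x)) \<in> cycle_interior G vs \<longleftrightarrow> pos G (wh x) \<in> cycle_interior G vs"
proof (cases "x \<in> set cs")
  case True
  then show ?thesis
    using pos_on_cycle inside_no_overlap unfolding cycle_interior_def by blast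
next
  case False
  let ?S = "\<Union>e\<in>cycle_edges G vs. path_image (curve G e)"
  let ?p = "path_image (curve G (bl (\<sigma> x), wh x))"
  have E: "(bl (\<sigma> x), wh x) \<in> edges G" using assms by (rule \<sigma>_edge)
  have "connected ?p"
    using arc_curve[OF E] by (simp add: arc_def connected_path_image)
  moreover have "?p \<subseteq> - ?S"
    using matching_edge_avoids_cycle[OF assms False] by blast
  moreover have "pos G (bl (\<sigma> x)) \<in> ?p" "pos G (wh x) \<in> ?p"
    using curve_verts[OF E] by blast+
  ultimately have "connected_component (- ?S) (pos G (bl (\<sigma> x))) (pos G (wh x))"
    unfolding connected_component_def by blast
  then show ?thesis
    unfolding cycle_interior_def
    using inside_same_component connected_component_sym by blast
qed

lemma even_card_interior_verts: "even (card (interior_verts G vs))"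
proof -
  define J where "J = {x\<in>{..<n}. pos G (wh x) \<in> cycle_interior G vs}"
  have lt: "x < n" "\<sigma> x < n" if "x \<in> J" for x
    using that \<sigma>_permutes by (auto simp: J_def permutes_less)
  have "interior_verts G vs = wh ` J \<union> (\<lambda>x. bl (\<sigma> x)) ` J"
  proof (intro equalityI subsetI)
    fix v assume v: "v \<in> interior_verts G vs"
    then consider "v \<in> white G" | "v \<in> black G" by (auto simp: interior_verts_def verts_def)
    then show "v \<in> wh ` J \<union> (\<lambda>x. bl (\<sigma> x)) ` J"
    proof cases
      case 1
      then obtain i where "i < n" "v = wh i" by (rule white_obtain)
      with v show ?thesis by (auto simp: interior_verts_def J_def)
    next
      case 2
      then obtain j where j: "j < n" "v = bl j" by (rule black_obtain)
      have "\<sigma> ` {..<n} = {..<n}" using \<sigma>_permutes by (rule permutes_image)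
      with j obtain i where "i < n" "j = \<sigma> i" by blast
      with v j matched_vertices_interior_iff[of i] show ?thesis
        by (auto simp: interior_verts_def J_def)
    qed
  next
    fix v assume "v \<in> wh ` J \<union> (\<lambda>x. bl (\<sigma> x)) ` J"
    then obtain x where x: "x \<in> J" "v = wh x \<or> v = bl (\<sigma> x)" by auto
    then show "v \<in> interior_verts G vs"
      using lt[OF x(1)] wh_white bl_black matched_vertices_interior_iff[of x]
      by (auto simp: interior_verts_def J_def verts_def)
  qed
  moreover have "wh ` J \<inter> (\<lambda>x. bl (\<sigma> x)) ` J = {}"
    using lt bl_neq_wh by fastforce
  moreover have "finite J" by (simp add: J_def)
  moreover have "inj_on wh J" "inj_on (\<lambda>x. bl (\<sigma> x)) J"
    using lt by (auto simp: inj_on_def wh_eq_iff bl_eq_iff inj_eq[OF permutes_inj[OF \<sigma>_permutes]])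
  ultimately have "card (interior_verts G vs) = card J + card J"
    by (simp add: card_Un_disjoint card_image)
  then show ?thesis by simp
qed

lemma kasteleyn_class_on_vs:
  assumes "kasteleyn_class G k"
  shows "eval_class k (cycle_chain G vs) = of_nat (length cs - 1)"
proof -
  have "eval_class k (cycle_chain G vs) =
      of_nat (card (interior_verts G vs) + length vs div 2 + 1)"
    using assms cycle_vs by (simp only: kasteleyn_class_def)
  also have "\<dots> = of_nat (length cs - 1)"
    using even_card_interior_verts cs(3) by (intro of_nat_bit_eqI) (cases cs; simp add: length_vs)
  finally show ?thesis .
qed

end

text \<open>
  The orientation of the cycle is opposite to the one suggested by the left-hand side, but values
  in \<open>\<int>/(2)\<close> do not see it. Lists of length at most one give the identity permutation, for which
  both sides vanish; allowing them spares case distinctions in the induction over cycles.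
\<close>

lemma kasteleyn_cycle_swap:
  fixes c :: "'v \<times> 'v \<Rightarrow> bit"
  assumes k: "kasteleyn_class G (cohomology_class G c)"
    and \<sigma>: "admissible \<sigma>" and \<rho>: "admissible (\<sigma> \<circ> cycle_of_list cs)"
    and cs: "distinct cs" "set cs \<subseteq> {..<n}"
  shows "(\<Sum>i<n. c (bl ((\<sigma> \<circ> cycle_of_list cs) i), wh i)) - (\<Sum>i<n. c (bl (\<sigma> i), wh i)) =
    of_nat (length cs - 1)"
proof (cases "2 \<le> length cs")
  case True
  note chain = cycle_chain_vs[OF \<sigma> \<rho> cs True refl refl]
  have "of_nat (length cs - 1) = eval_cochain c
     (matching_chain (permutation_matching \<sigma>) -
      matching_chain (permutation_matching (\<sigma> \<circ> cycle_of_list cs)))"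
    using kasteleyn_class_on_vs[OF \<sigma> \<rho> cs True refl refl k]
    by (simp add: chain eval_class_cohomology_class[OF matching_diff_closed[OF \<sigma> \<rho>]])
  then show ?thesis
    by (simp only: eval_cochain_matching_diff) (rule bit_diff_commute)
next
  case False
  then have "length cs = 0 \<or> length cs = 1" by linarith
  then have "cycle_of_list cs = id" "length cs - 1 = 0"
    by (auto simp: length_Suc_conv)
  then show ?thesis by simp
qed


section \<open>The sign rule\<close>

text \<open>
  Induction over the cycle decomposition of \<open>p\<close>. Dropping a cycle \<open>cs\<close> from \<open>p\<close> leaves a
  matching of \<open>G\<close>: on the remaining cycles the edges are unchanged, elsewhere they are those of \<open>\<tau>\<close>.
  Since disjoint cycles commute, \<open>cs\<close> can be moved next to the row index, where it is
  of the form treated by \<open>kasteleyn_cycle_swap\<close>.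
\<close>

lemma kasteleyn_sign_decomp:
  fixes c :: "'v \<times> 'v \<Rightarrow> bit"
  assumes k: "kasteleyn_class G (cohomology_class G c)" and \<tau>: "admissible \<tau>"
  shows "cycle_decomp I p \<Longrightarrow> I \<subseteq> {..<n} \<Longrightarrow> admissible (\<tau> \<circ> p) \<Longrightarrow>
    eta (half ((\<Sum>i<n. c (bl ((\<tau> \<circ> p) i), wh i)) - (\<Sum>i<n. c (bl (\<tau> i), wh i)))) = of_int (sign p)"
proof (induction rule: cycle_decomp.induct)
  case empty
  then show ?case by simp
next
  case (comp I p cs)
  let ?c = "cycle_of_list cs"
  define K where "K \<sigma> = (\<Sum>i<n. c (bl (\<sigma> i), wh i))" for \<sigma>
  have p: "p permutes I" using comp.hyps(1) by (rule cycle_decomp_permutes)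
  have perms: "\<tau> permutes {..<n}" "p permutes {..<n}" "?c permutes {..<n}"
    using \<tau> permutes_subset[OF p] permutes_subset[OF cycle_permutes] comp.prems(1)
    by (auto simp: admissible_def)
  have commute: "?c \<circ> p = p \<circ> ?c"
  proof
    fix i
    consider "i \<in> I" "i \<notin> set cs" | "i \<in> set cs" "i \<notin> I" | "i \<notin> I" "i \<notin> set cs"
      using comp.hyps(3) by blast
    then show "(?c \<circ> p) i = (p \<circ> ?c) i"
    proof cases
      case 1
      then have "p i \<notin> set cs" using permutes_in_image[OF p, of i] comp.hyps(3) by auto
      with 1 show ?thesis by (simp add: id_outside_supp)
    next
      case 2
      then have "?c i \<notin> I" using permutes_in_image[OF cycle_permutes, of cs i] comp.hyps(3) by auto
      with 2 show ?thesis by (simp add: permutes_not_in[OF p])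
    next
      case 3
      then show ?thesis by (simp add: permutes_not_in[OF p] id_outside_supp)
    qed
  qed
  have "(bl ((\<tau> \<circ> p) i), wh i) \<in> edges G" if i: "i < n" for i
  proof (cases "i \<in> I")
    case True
    then have "?c i = i" using comp.hyps(3) by (auto intro: id_outside_supp)
    then have "(\<tau> \<circ> p) i = (\<tau> \<circ> (?c \<circ> p)) i" by (simp add: commute)
    then show ?thesis using comp.prems(2) i by (simp add: admissible_def)
  next
    case False
    then show ?thesis using \<tau> i by (simp add: permutes_not_in[OF p] admissible_def)
  qed
  then have \<sigma>: "admissible (\<tau> \<circ> p)"
    using perms by (simp add: admissible_def permutes_compose)
  have eq: "\<tau> \<circ> (?c \<circ> p) = (\<tau> \<circ> p) \<circ> ?c" by (simp add: commute comp_assoc)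
  have swap: "K (\<tau> \<circ> (?c \<circ> p)) - K (\<tau> \<circ> p) = of_nat (length cs - 1)"
    unfolding K_def eq
    using comp.prems(1) by (intro kasteleyn_cycle_swap k \<sigma> comp.prems(2)[unfolded eq] comp.hyps(2)) simp
  have IH: "eta (half (K (\<tau> \<circ> p) - K \<tau>)) = of_int (sign p)"
    unfolding K_def using comp.prems(1) by (intro comp.IH[OF _ \<sigma>]) auto
  have "half (K (\<tau> \<circ> (?c \<circ> p)) - K \<tau>) =
      half (K (\<tau> \<circ> (?c \<circ> p)) - K (\<tau> \<circ> p)) + half (K (\<tau> \<circ> p) - K \<tau>)"
    unfolding half_diff by simp
  then have "eta (half (K (\<tau> \<circ> (?c \<circ> p)) - K \<tau>)) = (-1) ^ (length cs - 1) * of_int (sign p)"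
    by (simp only: eta_add swap IH eta_half_of_nat)
  also have "\<dots> = of_int (sign (?c \<circ> p))"
  proof -
    have "permutation p" using perms(2) permutation_permutes by blast
    then have "sign (?c \<circ> p) = sign ?c * sign p"
      by (rule sign_compose[OF permutation_of_cycle])
    then show ?thesis using sign_cycle_of_list[OF comp.hyps(2)] by simp
  qed
  finally show ?case by (simp only: K_def)
qed

lemma kasteleyn_sign:
  fixes c :: "'v \<times> 'v \<Rightarrow> bit"
  assumes k: "kasteleyn_class G (cohomology_class G c)"
    and \<sigma>: "admissible \<sigma>" and \<tau>: "admissible \<tau>"
  shows "eta (half ((\<Sum>i<n. c (bl (\<sigma> i), wh i)) - (\<Sum>i<n. c (bl (\<tau> i), wh i)))) =
    of_int (sign \<sigma> * sign \<tau>)"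
proof -
  have perms: "\<sigma> permutes {..<n}" "\<tau> permutes {..<n}"
    using \<sigma> \<tau> by (auto simp: admissible_def)
  let ?p = "Hilbert_Choice.inv \<tau> \<circ> \<sigma>"
  have p: "?p permutes {..<n}" using perms by (simp add: permutes_compose permutes_inv)
  have \<sigma>_eq: "\<tau> \<circ> ?p = \<sigma>"
    using permutes_inv_o(1)[OF perms(2)] by (simp add: comp_assoc[symmetric])
  have "permutation \<sigma>" "permutation \<tau>" using perms permutation_permutes by blast+
  then have "sign ?p = sign \<sigma> * sign \<tau>"
    by (simp add: sign_compose sign_inverse permutation_inverse del: comp_apply)
  moreover have "cycle_decomp {..<n} ?p"
    using p by (rule cycle_decomposition) simp
  note kasteleyn_sign_decomp[OF k \<tau> this, unfolded \<sigma>_eq]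
  ultimately show ?thesis using \<sigma> by simp
qed


section \<open>Expanding the determinant\<close>

text \<open>
  The cochain is well defined because \<open>eta\<close> is a bijection onto the unit circle and every edge
  is \<open>(bl j, wh i)\<close> for exactly one pair of indices.
\<close>

lemma matrix_cochain:
  assumes A: "generalized_kasteleyn_matrix G n wh bl A"
  shows "matrix_cochain G n wh bl A \<in> carrier (C1 G)"
    and "\<And>i j. i < n \<Longrightarrow> j < n \<Longrightarrow> (bl j, wh i) \<in> edges G \<Longrightarrow>
           eta (matrix_cochain G n wh bl A (bl j, wh i)) = A $$ (i, j)"
proof -
  let ?P = "\<lambda>c. c \<in> carrier (C1 G) \<and>
     (\<forall>i<n. \<forall>j<n. (bl j, wh i) \<in> edges G \<longrightarrow> A $$ (i, j) = eta (c (bl j, wh i)))"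
  have edge: "\<exists>i<n. \<exists>j<n. e = (bl j, wh i)" if "e \<in> edges G" for e
  proof -
    have "fst e \<in> black G" "snd e \<in> white G" using that edges_subset by auto
    then show ?thesis by (metis black_obtain white_obtain prod.collapse)
  qed
  have "\<exists>t. (e \<notin> edges G \<longrightarrow> t = 0) \<and>
      (\<forall>i<n. \<forall>j<n. e = (bl j, wh i) \<and> e \<in> edges G \<longrightarrow> A $$ (i, j) = eta t)" for e
  proof (cases "e \<in> edges G")
    case True
    then obtain i j where ij: "i < n" "j < n" "e = (bl j, wh i)" using edge by blast
    then have "cmod (A $$ (i, j)) = 1"
      using A True by (auto simp: generalized_kasteleyn_matrix_def)
    then obtain t where "eta t = A $$ (i, j)" by (rule eta_surj_unit_circle)
    with ij True show ?thesis by (intro exI[of _ t]) (auto simp: wh_eq_iff bl_eq_iff)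
  qed simp
  then obtain c where "\<And>e. (e \<notin> edges G \<longrightarrow> c e = 0) \<and>
      (\<forall>i<n. \<forall>j<n. e = (bl j, wh i) \<and> e \<in> edges G \<longrightarrow> A $$ (i, j) = eta (c e))"
    by metis
  then have c: "?P c" by (auto simp: C1_def)
  moreover have "d = c" if d: "?P d" for d
  proof
    fix e
    show "d e = c e"
    proof (cases "e \<in> edges G")
      case True
      then obtain i j where "i < n" "j < n" "e = (bl j, wh i)" using edge by blast
      with True c d have "eta (d e) = eta (c e)" by metis
      then show ?thesis using inj_eta by (simp add: inj_eq)
    next
      case False
      then show ?thesis using c d by (cases e) (auto simp: C1_def)
    qed
  qed
  ultimately have "?P (matrix_cochain G n wh bl A)"
    unfolding matrix_cochain_def by (rule theI)
  then show "matrix_cochain G n wh bl A \<in> carrier (C1 G)"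
    and "\<And>i j. i < n \<Longrightarrow> j < n \<Longrightarrow> (bl j, wh i) \<in> edges G \<Longrightarrow>
           eta (matrix_cochain G n wh bl A (bl j, wh i)) = A $$ (i, j)"
    by auto
qed

lemma det_eq_sum_admissible:
  assumes A: "generalized_kasteleyn_matrix G n wh bl A"
  shows "Determinant.det A = (\<Sum>\<sigma> | admissible \<sigma>.
    of_int (sign \<sigma>) * eta (\<Sum>i<n. matrix_cochain G n wh bl A (bl (\<sigma> i), wh i)))"
proof -
  have "A \<in> carrier_mat n n" using A by (simp add: generalized_kasteleyn_matrix_def)
  then have "Determinant.det A =
      (\<Sum>\<sigma> | \<sigma> permutes {..<n}. of_int (sign \<sigma>) * (\<Prod>i<n. A $$ (i, \<sigma> i)))"
    by (simp add: det_def' lessThan_atLeast0)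
  also have "\<dots> = (\<Sum>\<sigma> | admissible \<sigma>. of_int (sign \<sigma>) * (\<Prod>i<n. A $$ (i, \<sigma> i)))"
  proof (rule sum.mono_neutral_right)
    show "\<forall>\<sigma>\<in>{\<sigma>. \<sigma> permutes {..<n}} - {\<sigma>. admissible \<sigma>}.
        of_int (sign \<sigma>) * (\<Prod>i<n. A $$ (i, \<sigma> i)) = 0"
    proof
      fix \<sigma> assume "\<sigma> \<in> {\<sigma>. \<sigma> permutes {..<n}} - {\<sigma>. admissible \<sigma>}"
      then obtain i where i: "i < n" "(bl (\<sigma> i), wh i) \<notin> edges G" and \<sigma>: "\<sigma> permutes {..<n}"
        by (auto simp: admissible_def)
      then have "A $$ (i, \<sigma> i) = 0"
        using A by (simp add: generalized_kasteleyn_matrix_def permutes_less)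
      then have "(\<Prod>i<n. A $$ (i, \<sigma> i)) = 0" using i by auto
      then show "of_int (sign \<sigma>) * (\<Prod>i<n. A $$ (i, \<sigma> i)) = 0" by simp
    qed
  qed (auto simp: finite_permutations admissible_def)
  also have "\<dots> = (\<Sum>\<sigma> | admissible \<sigma>.
    of_int (sign \<sigma>) * eta (\<Sum>i<n. matrix_cochain G n wh bl A (bl (\<sigma> i), wh i)))"
  proof (rule sum.cong[OF refl])
    fix \<sigma> assume "\<sigma> \<in> {\<sigma>. admissible \<sigma>}"
    then have "(\<Prod>i<n. A $$ (i, \<sigma> i)) = (\<Prod>i<n. eta (matrix_cochain G n wh bl A (bl (\<sigma> i), wh i)))"
      by (intro prod.cong) (auto simp: admissible_def permutes_less matrix_cochain(2)[OF A])
    then show "of_int (sign \<sigma>) * (\<Prod>i<n. A $$ (i, \<sigma> i)) =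
        of_int (sign \<sigma>) * eta (\<Sum>i<n. matrix_cochain G n wh bl A (bl (\<sigma> i), wh i))"
      by (simp add: eta_sum)
  qed
  finally show ?thesis .
qed

lemma delta_cohomology_class:
  "delta (cohomology_class G d) G = (\<Sum>\<sigma> | admissible \<sigma>. \<Sum>\<tau> | admissible \<tau>.
     eta ((\<Sum>i<n. d (bl (\<sigma> i), wh i)) - (\<Sum>i<n. d (bl (\<tau> i), wh i))))"
  unfolding delta_def sum.reindex_bij_betw[OF bij_betw_permutation_matching, symmetric]
  by (intro sum.cong refl)
    (simp add: eval_class_cohomology_class[OF matching_diff_closed] eval_cochain_matching_diff)

theorem norm_det_squared:
  assumes A: "generalized_kasteleyn_matrix G n wh bl A" and k: "kasteleyn_class G k"
  shows "complex_of_real ((cmod (Determinant.det A))\<^sup>2) =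
         delta (matrix_class G n wh bl A \<otimes>\<^bsub>H1 G\<^esub> coeff_map G half k) G"
proof -
  define a where "a = matrix_cochain G n wh bl A"
  define a_sum where "a_sum \<sigma> = (\<Sum>i<n. a (bl (\<sigma> i), wh i))" for \<sigma>
  obtain c where c: "c \<in> carrier (C1 G)" and k_eq: "k = cohomology_class G c"
    using k unfolding kasteleyn_class_def by (blast elim: H1_carrier_obtain)
  define c_sum where "c_sum \<sigma> = (\<Sum>i<n. c (bl (\<sigma> i), wh i))" for \<sigma>
  have sign: "eta (half (c_sum \<sigma> - c_sum \<tau>)) = of_int (sign \<sigma> * sign \<tau>)"
    if "admissible \<sigma>" "admissible \<tau>" for \<sigma> \<tau>
    unfolding c_sum_def using k that by (intro kasteleyn_sign) (simp_all add: k_eq)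
  have "complex_of_real ((cmod (Determinant.det A))\<^sup>2) = Determinant.det A * cnj (Determinant.det A)"
    by (simp add: complex_norm_square[symmetric])
  also have "\<dots> = (\<Sum>\<sigma> | admissible \<sigma>. \<Sum>\<tau> | admissible \<tau>.
      (of_int (sign \<sigma>) * eta (a_sum \<sigma>)) * cnj (of_int (sign \<tau>) * eta (a_sum \<tau>)))"
    unfolding det_eq_sum_admissible[OF A] cnj_sum sum_product a_sum_def a_def ..
  also have "\<dots> = (\<Sum>\<sigma> | admissible \<sigma>. \<Sum>\<tau> | admissible \<tau>.
      eta ((\<Sum>i<n. a (bl (\<sigma> i), wh i) + (half \<circ> c) (bl (\<sigma> i), wh i)) -
           (\<Sum>i<n. a (bl (\<tau> i), wh i) + (half \<circ> c) (bl (\<tau> i), wh i))))"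
  proof (intro sum.cong refl)
    fix \<sigma> \<tau>
    assume "\<sigma> \<in> {\<sigma>. admissible \<sigma>}" "\<tau> \<in> {\<tau>. admissible \<tau>}"
    then have st: "eta (half (c_sum \<sigma> - c_sum \<tau>)) = of_int (sign \<sigma> * sign \<tau>)"
      by (intro sign) simp_all
    have "(\<Sum>i<n. a (bl (\<sigma> i), wh i) + (half \<circ> c) (bl (\<sigma> i), wh i)) -
           (\<Sum>i<n. a (bl (\<tau> i), wh i) + (half \<circ> c) (bl (\<tau> i), wh i)) =
        (a_sum \<sigma> - a_sum \<tau>) + half (c_sum \<sigma> - c_sum \<tau>)"
      by (simp only: sum.distrib a_sum_def c_sum_def half_diff half_sum comp_apply)
        (simp add: algebra_simps)
    then show "(of_int (sign \<sigma>) * eta (a_sum \<sigma>)) * cnj (of_int (sign \<tau>) * eta (a_sum \<tau>)) =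
        eta ((\<Sum>i<n. a (bl (\<sigma> i), wh i) + (half \<circ> c) (bl (\<sigma> i), wh i)) -
           (\<Sum>i<n. a (bl (\<tau> i), wh i) + (half \<circ> c) (bl (\<tau> i), wh i)))"
      by (simp only: eta_add eta_diff st) (simp add: mult_ac)
  qed
  also have "\<dots> = delta (cohomology_class G (\<lambda>e. a e + (half \<circ> c) e)) G"
    by (simp only: delta_cohomology_class)
  also have "cohomology_class G (\<lambda>e. a e + (half \<circ> c) e) =
      matrix_class G n wh bl A \<otimes>\<^bsub>H1 G\<^esub> coeff_map G half k"
    unfolding k_eq matrix_class_def a_def coeff_map_cohomology_class(1)[OF half_add c]
    by (intro H1_mult_cohomology_class[symmetric] matrix_cochain(1)[OF A]
        coeff_map_cohomology_class(2)[OF half_add c])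
  finally show ?thesis .
qed

end

theorem lemma1p4:
  fixes G :: "'v drawn_graph" and n :: nat and wh bl :: "nat \<Rightarrow> 'v"
    and A :: "complex mat" and k :: "('v \<times> 'v \<Rightarrow> bit) set"
  assumes "plane_bipartite_graph G"
    and "bij_betw wh {..<n} (white G)"
    and "bij_betw bl {..<n} (black G)"
    and "generalized_kasteleyn_matrix G n wh bl A"
    and "kasteleyn_class G k"
  shows "complex_of_real ((cmod (Determinant.det A))\<^sup>2) =
         delta (matrix_class G n wh bl A \<otimes>\<^bsub>H1 G\<^esub> coeff_map G half k) G"
proof -
  interpret numbered_plane_graph G n wh bl
    using assms(1-3) by (simp add: numbered_plane_graph_def numbered_plane_graph_axioms_def)
  show ?thesis using assms(4,5) by (rule norm_det_squared)
qed

end
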